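(* Let $p$ be an odd prime, $m$ even, $M=\mathbb F_{p^m}$, $Q=p^{m/2}$, $1\le k\le m-1$, $q=p^k$, $r=p^{k+m/2}$, $e=\gcd(k,m)$ with $m/e$ odd, $d=\gcd(k+m/2,m)$, $\mathbb E=\mathbb F_{p^e}$, $\mathbb D=\mathbb F_{p^d}$, $B\in M$ a non-square, $A\in M$ with $AB\in\mathbb F_Q^\times$, and $\mathcal C$ as in the context. Suppose $(X,Y)\in\mathrm{Aut}(\mathcal C)$ with $X(x,y)=(a_1x^{p^i},d_1y^{p^i})$ and $Y(x,y)=(b_2y^{p^i},c_2x^{p^i})$ for some $0\le i<m$ and $a_1,d_1,b_2,c_2\in M^\times$. Then there exist $\alpha\in M$, $\delta\in\mathbb D$ such that $\alpha^{r-1}=A^{p^i+1}$ and $\alpha^{q+1}\delta=B^{p^i+1}$, and $\delta$ can be written as $\delta=\gamma^{p^d+1}\varepsilon^2$ with $\gamma\in\mathbb E$, $\varepsilon\in\mathbb D$ in exactly $p^e-1$ ways. In total, for each $i$ for which these conditions can be satisfied, there are exactly $(p^m-1)(p^e-1)$ such automorphisms.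
   Context: $\mathcal C=\{R_{u,v}:u,v\in M\}$, where $R_{u,v}(x,y)=(x^qu+xu^q+B(y^qv+yv^q),\ x^rv+Axv^r+Ay^ru+yu^r)$. $\mathrm{Aut}(\mathcal C)$ is the set of pairs $(X,Y)$ of invertible $\mathbb F_p$-linear maps of $M\times M$ such that for every $(u,v)\in M^2$ there is $(w,t)\in M^2$ with $X\circ R_{u,v}=R_{w,t}\circ Y$ (equivalently $\{X\circ R\circ Y^{-1}:R\in\mathcal C\}=\mathcal C$). *)

theory Defs
  imports "HOL-Computational_Algebra.Primes" "HOL-Library.Product_Plus" "HOL-Library.Cardinality"
begin

definition is_subfield :: "'a::field set \<Rightarrow> bool" where
  "is_subfield K \<longleftrightarrow> 1 \<in> K \<and> (\<forall>x\<in>K. \<forall>y\<in>K. x - y \<in> K \<and> x * y \<in> K) \<and> (\<forall>x\<in>K. inverse x \<in> K)"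

definition linear_over :: "'a::field set \<Rightarrow> ('a \<times> 'a \<Rightarrow> 'a \<times> 'a) \<Rightarrow> bool" where
  "linear_over K f \<longleftrightarrow>
     (\<forall>z w. f (z + w) = f z + f w) \<and>
     (\<forall>c\<in>K. \<forall>x y. f (c * x, c * y) = (c * fst (f (x, y)), c * snd (f (x, y))))"

text \<open>In a field of characteristic p, the prime field is the range of \<^const>\<open>of_int\<close>.\<close>

definition prime_field :: "'a::field set" where
  "prime_field = range of_int"

definition R_map :: "nat \<Rightarrow> nat \<Rightarrow> 'a \<Rightarrow> 'a \<Rightarrow> 'a \<Rightarrow> 'a \<Rightarrow> 'a \<times> 'a \<Rightarrow> 'a::field \<times> 'a" where
  "R_map q r A B u v = (\<lambda>(x, y).
     (x ^ q * u + x * u ^ q + B * (y ^ q * v + y * v ^ q),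
      x ^ r * v + A * x * v ^ r + A * y ^ r * u + y * u ^ r))"

definition C_set :: "nat \<Rightarrow> nat \<Rightarrow> 'a \<Rightarrow> 'a \<Rightarrow> ('a \<times> 'a \<Rightarrow> 'a::field \<times> 'a) set" where
  "C_set q r A B = {R_map q r A B u v | u v. True}"

definition Aut_set :: "('a \<times> 'a \<Rightarrow> 'a::field \<times> 'a) set \<Rightarrow>
    (('a \<times> 'a \<Rightarrow> 'a \<times> 'a) \<times> ('a \<times> 'a \<Rightarrow> 'a \<times> 'a)) set" where
  "Aut_set C = {(X, Y).
     linear_over prime_field X \<and> bij X \<and> linear_over prime_field Y \<and> bij Y \<and>
     (\<forall>R\<in>C. \<exists>R'\<in>C. X \<circ> R = R' \<circ> Y)}"

end

theory Submission
  imports Defs "HOL-Computational_Algebra.Polynomial"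
begin

text \<open>
  Write \<open>s = p ^ i\<close> and \<open>P = p ^ d\<close>. Since \<open>m / e\<close> is odd, \<open>e = 2 d\<close>, so \<open>E\<close> is a quadratic extension of
  \<open>D\<close> on which the \<open>q\<close>-power map is trivial and the \<open>r\<close>-power map is the conjugation
  \<open>x \<mapsto> x ^ P\<close>. Comparing coefficients shows that the pair given by \<open>a1, d1, b2, c2\<close> is an
  autotopism iff \<open>b2 = \<alpha> c2 \<gamma>\<close>, \<open>a1 = B c2 ^ (q + 1) / \<gamma> ^ P\<close> and \<open>d1 = A \<alpha> c2 ^ (r + 1)\<close> for
  some nonzero \<open>\<gamma> \<in> E\<close> and some \<open>\<alpha>\<close> with \<open>\<alpha> ^ (r - 1) = A ^ (s + 1)\<close> and
  \<open>\<alpha> ^ (q + 1) N(\<gamma>) = B ^ (s + 1)\<close>, where \<open>N(\<gamma>) = \<gamma> ^ (P + 1)\<close> is the norm from \<open>E\<close> to \<open>D\<close>.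
  Two solutions \<open>\<alpha>\<close> of the first equation differ by a factor \<open>\<epsilon> \<in> D\<close>, which changes the second
  by \<open>\<epsilon>\<^sup>2\<close>. So for each \<open>c2\<close> the admissible pairs correspond to the representations
  \<open>\<delta> = N(\<gamma>) \<epsilon>\<^sup>2\<close> of one fixed \<open>\<delta>\<close>, and there are \<open>(P - 1) (P + 1)\<close> of them because
  all fibres of the norm have \<open>P + 1\<close> elements.
\<close>

section \<open>Subfields of finite fields\<close>

lemma is_subfield_zero: "is_subfield K \<Longrightarrow> 0 \<in> K"
  unfolding is_subfield_def by (metis diff_self)

lemma is_subfield_one: "is_subfield K \<Longrightarrow> 1 \<in> K"
  unfolding is_subfield_def by blast

lemma is_subfield_mult: "is_subfield K \<Longrightarrow> x \<in> K \<Longrightarrow> y \<in> K \<Longrightarrow> x * y \<in> K"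
  unfolding is_subfield_def by blast

lemma is_subfield_divide: "is_subfield K \<Longrightarrow> x \<in> K \<Longrightarrow> y \<in> K \<Longrightarrow> x / y \<in> K"
  unfolding is_subfield_def divide_inverse by blast

lemma is_subfield_power: "is_subfield K \<Longrightarrow> x \<in> K \<Longrightarrow> x ^ n \<in> K"
  by (induction n) (auto intro: is_subfield_mult is_subfield_one)

lemma is_subfield_UNIV: "is_subfield UNIV"
  by (simp add: is_subfield_def)

lemma is_subfield_card_gt_1:
  fixes K :: "'a :: {field,finite} set"
  assumes "is_subfield K"
  shows "1 < card K"
proof -
  have "card {0, 1 :: 'a} \<le> card K"
    using is_subfield_zero[OF assms] is_subfield_one[OF assms] by (intro card_mono) auto
  then show ?thesis by simp
qed

text \<open>Multiplication by a nonzero \<open>x\<close> permutes \<open>K - {0}\<close>, so the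
  product of all nonzero elements absorbs the factor \<open>x ^ (card K - 1)\<close>, which is
  therefore 1.\<close>

lemma is_subfield_power_card:
  fixes x :: "'a :: {field,finite}"
  assumes K: "is_subfield K" and x: "x \<in> K"
  shows "x ^ card K = x"
proof (cases "x = 0")
  case False
  have "(\<Prod>y\<in>K - {0}. x * y) = (\<Prod>y\<in>K - {0}. y)"
    by (rule prod.reindex_bij_witness[of _ "\<lambda>y. y / x" "\<lambda>y. x * y"])
       (use False in \<open>auto simp: is_subfield_mult[OF K x] is_subfield_divide[OF K _ x]\<close>)
  then have "x ^ card (K - {0}) * \<Prod>(K - {0}) = 1 * \<Prod>(K - {0})"
    by (simp add: prod.distrib)
  moreover have "\<Prod>(K - {0}) \<noteq> 0"
    by (subst prod_zero_iff) auto
  ultimately have "x ^ card (K - {0}) = 1"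
    using mult_right_cancel by blast
  moreover have "card K = Suc (card (K - {0}))"
    using is_subfield_zero[OF K] by (metis card_Suc_Diff1 finite)
  ultimately show ?thesis by simp
next
  case True
  have "card K \<noteq> 0"
    using is_subfield_card_gt_1[OF K] by linarith
  with True show ?thesis by (simp add: card_gt_0_iff)
qed

lemma card_power_roots_le:
  fixes a :: "'a :: idom"
  assumes "0 < n"
  shows "card {x. x ^ n = a} \<le> n"
proof -
  have deg: "degree (monom 1 n - [:a:]) \<le> n"
    by (intro degree_diff_le) (auto simp: degree_monom_le)
  have "degree (monom 1 n :: 'a poly) \<noteq> degree [:a:]"
    using assms by (simp add: degree_monom_eq)
  then have "monom 1 n - [:a:] \<noteq> 0" by auto
  from card_poly_roots_bound[OF this] deg show ?thesis
    by (simp add: poly_monom)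
qed

text \<open>The polynomial \<open>X ^ card K - X\<close> has at most \<open>card K\<close> roots and
  vanishes on \<open>K\<close>, so \<open>K\<close> is its full root set.\<close>

lemma is_subfield_mem_iff:
  fixes K :: "'a :: {field,finite} set"
  assumes K: "is_subfield K"
  shows "x \<in> K \<longleftrightarrow> x ^ card K = x"
proof -
  let ?n = "card K"
  have n: "1 < ?n"
    by (rule is_subfield_card_gt_1[OF K])
  let ?f = "monom 1 ?n - [:0, 1:] :: 'a poly"
  have deg: "degree ?f \<le> ?n"
    using n by (intro degree_diff_le) (auto simp: degree_monom_le)
  have "degree (monom 1 ?n :: 'a poly) \<noteq> degree [:0, 1 :: 'a:]"
    using n by (simp add: degree_monom_eq)
  then have "?f \<noteq> 0" by auto
  from card_poly_roots_bound[OF this] deg have "card {x :: 'a. x ^ ?n = x} \<le> card K"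
    by (simp add: poly_monom)
  moreover have "K \<subseteq> {x. x ^ ?n = x}"
    using is_subfield_power_card[OF K] by blast
  ultimately have "K = {x. x ^ ?n = x}"
    by (intro card_seteq) auto
  then show ?thesis by blast
qed

section \<open>Elements fixed by iterated \<open>p\<close>-power maps\<close>

lemma power_power_fixed:
  fixes x :: "'a :: monoid_mult"
  assumes "x ^ (p ^ n) = x"
  shows "x ^ (p ^ (n * j)) = x"
  using assms by (induction j) (simp_all add: power_add power_mult)

text \<open>Euclid's algorithm on the numbers of iterations: if \<open>b\<close> iterations of the
  \<open>p\<close>-power map fix \<open>x\<close>, then \<open>a\<close> iterations act on
  \<open>x\<close> as \<open>a mod b\<close> do.\<close>

lemma power_power_fixed_gcd:
  fixes x :: "'a :: monoid_mult"
  assumes "x ^ (p ^ a) = x" "x ^ (p ^ b) = x"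
  shows "x ^ (p ^ gcd a b) = x"
  using assms
proof (induction a b rule: gcd_nat_induct)
  case (step a b)
  have "x ^ (p ^ a) = (x ^ (p ^ (b * (a div b)))) ^ (p ^ (a mod b))"
    by (simp flip: power_mult power_add)
  then have "x ^ (p ^ (a mod b)) = x"
    using power_power_fixed[OF step.prems(2)] step.prems(1) by simp
  with step show ?case
    by (simp add: gcd_red_nat[of a b])
qed simp

lemma is_subfield_mem_iff_gcd:
  fixes K :: "'a :: {field,finite} set"
  assumes "is_subfield K" "card K = p ^ gcd n m" "CARD('a) = p ^ m"
  shows "x \<in> K \<longleftrightarrow> x ^ (p ^ n) = x"
proof -
  have "x ^ (p ^ m) = x"
    using is_subfield_power_card[OF is_subfield_UNIV, of x] assms(3) by simp
  then have "x ^ (p ^ gcd n m) = x \<longleftrightarrow> x ^ (p ^ n) = x"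
    using power_power_fixed_gcd power_power_fixed
    by (metis dvdE gcd_dvd1)
  then show ?thesis
    using is_subfield_mem_iff[OF assms(1)] assms(2) by simp
qed

section \<open>The norm of a quadratic extension\<close>

lemma card_field_norm_fibre:
  fixes K L :: "'a :: {field,finite} set"
  assumes K: "is_subfield K" and L: "is_subfield L" and card: "card L = card K ^ 2"
    and a: "a \<in> K - {0}"
  shows "card {x \<in> L. x ^ (card K + 1) = a} = card K + 1"
proof -
  define n where "n = card K"
  define F where "F = (\<lambda>a. {x \<in> L. x ^ (n + 1) = a})"
  have n: "1 < n"
    using is_subfield_card_gt_1[OF K] by (simp add: n_def)
  have le: "card (F b) \<le> n + 1" for b
  proof -
    have "card (F b) \<le> card {x. x ^ (n + 1) = b}"
      by (intro card_mono) (auto simp: F_def)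
    also have "\<dots> \<le> n + 1"
      by (rule card_power_roots_le) simp
    finally show ?thesis .
  qed
  have mem: "x ^ (n + 1) \<in> K" if "x \<in> L" for x
  proof -
    \<comment> \<open>The \<open>n\<close>-power map is an involution on \<open>L\<close>, so it
      only swaps the factors \<open>x\<close> and \<open>x ^ n\<close> of the norm.\<close>
    have "(x ^ (n + 1)) ^ n = x ^ (n ^ 2) * x ^ n"
      by (simp add: power2_eq_square power_mult power_add power_mult_distrib)
    also have "x ^ (n ^ 2) = x"
      using is_subfield_power_card[OF L that] card by (simp add: n_def)
    finally show ?thesis
      using is_subfield_mem_iff[OF K] by (simp add: n_def)
  qed
  have cardK: "card (K - {0}) = n - 1"
    using is_subfield_zero[OF K] by (simp add: n_def)
  have "L - {0} = (\<Union>b\<in>K - {0}. F b)"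
    using mem by (auto simp: F_def)
  moreover have "card (\<Union>b\<in>K - {0}. F b) = (\<Sum>b\<in>K - {0}. card (F b))"
    by (rule card_UN_disjoint) (auto simp: F_def)
  moreover have "card (L - {0}) = n ^ 2 - 1"
    using is_subfield_zero[OF L] card by (simp add: n_def)
  txt \<open>The \<open>n - 1\<close> fibres have at most \<open>n + 1\<close> elements each and together \<open>n\<^sup>2 - 1\<close>.\<close>
  ultimately have "(\<Sum>b\<in>K - {0}. card (F b)) = n ^ 2 - 1" by simp
  also have "n ^ 2 - 1 = (\<Sum>b\<in>K - {0}. n + 1)"
    using n by (simp add: cardK power2_eq_square algebra_simps)
  finally have "(\<Sum>b\<in>K - {0}. card (F b)) = (\<Sum>b\<in>K - {0}. n + 1)" .
  \<comment> \<open>Termwise bounds whose sums agree are all attained.\<close>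
  then have "card (F a) = n + 1"
    by (rule sum_mono_inv[OF _ le a]) simp
  then show ?thesis
    by (simp add: F_def n_def)
qed

text \<open>Each nonzero \<open>y\<close> fixes the norm of \<open>x\<close> as
  \<open>a / y ^ 2\<close>, which leaves \<open>card K + 1\<close> choices of \<open>x\<close>; the
  total is \<open>(card K - 1) * (card K + 1)\<close>. The value \<open>y = 0\<close> is excluded by
  \<open>a\<close> being nonzero.\<close>

lemma card_field_norm_times_square:
  fixes K L :: "'a :: {field,finite} set"
  assumes K: "is_subfield K" and L: "is_subfield L" and card: "card L = card K ^ 2"
    and a: "a \<in> K - {0}"
  shows "card {(x, y). x \<in> L \<and> y \<in> K \<and> a = x ^ (card K + 1) * y ^ 2} = card L - 1"
proof -
  define G where "G = (\<lambda>y. {x \<in> L. x ^ (card K + 1) = a / y ^ 2})"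
  have "{(x, y). x \<in> L \<and> y \<in> K \<and> a = x ^ (card K + 1) * y ^ 2}
      = prod.swap ` (SIGMA y:K - {0}. G y)"
    using a by (force simp: G_def field_simps image_iff)
  then have "card {(x, y). x \<in> L \<and> y \<in> K \<and> a = x ^ (card K + 1) * y ^ 2}
      = card (SIGMA y:K - {0}. G y)"
    by (simp add: card_image)
  also have "\<dots> = (\<Sum>y\<in>K - {0}. card (G y))"
    by (rule card_SigmaI) auto
  also have "\<dots> = (\<Sum>y\<in>K - {0}. card K + 1)"
  proof (rule sum.cong)
    fix y assume "y \<in> K - {0}"
    then have "a / y ^ 2 \<in> K - {0}"
      using a by (simp add: is_subfield_divide[OF K] is_subfield_power[OF K])
    then show "card (G y) = card K + 1"
      unfolding G_def by (rule card_field_norm_fibre[OF K L card])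
  qed simp
  also have "\<dots> = card L - 1"
    using is_subfield_card_gt_1[OF K] is_subfield_zero[OF K] card
    by (simp add: power2_eq_square algebra_simps)
  finally show ?thesis .
qed

section \<open>The Frobenius map\<close>

text \<open>Translation by 1 permutes the field, so summing \<open>x + 1\<close> over all
  \<open>x\<close> shows that the cardinality is zero in the field.\<close>

lemma CHAR_eq_if_CARD_eq_prime_power:
  assumes "prime p" "CARD('a :: {field,finite}) = p ^ m"
  shows "CHAR('a) = p"
proof -
  have "(\<Sum>x\<in>UNIV. x + 1 :: 'a) = (\<Sum>x\<in>UNIV. x)"
    by (rule sum.reindex_bij_witness[of _ "\<lambda>x. x - 1" "\<lambda>x. x + 1"]) auto
  then have "of_nat (p ^ m) = (0 :: 'a)"
    using assms(2) by (simp add: sum.distrib)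
  then have "CHAR('a) dvd p ^ m"
    by (simp only: of_nat_eq_0_iff_char_dvd)
  moreover have "prime CHAR('a)"
    by (intro prime_CHAR_semidom finite_imp_CHAR_pos) simp
  ultimately show ?thesis
    using assms(1) prime_dvd_power primes_dvd_imp_eq by blast
qed

text \<open>Additivity reduces injectivity to cancelling \<open>(x - y) ^ CHAR('a) ^ n = 0\<close>;
  finiteness then gives surjectivity.\<close>

lemma bij_frobenius_power:
  assumes "prime CHAR('a :: {field,finite})"
  shows "bij (\<lambda>x :: 'a. x ^ CHAR('a) ^ n)"
proof -
  have "x = y" if "x ^ CHAR('a) ^ n = y ^ CHAR('a) ^ n" for x y :: 'a
  proof -
    have "x ^ CHAR('a) ^ n = (x - y) ^ CHAR('a) ^ n + y ^ CHAR('a) ^ n"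
      using freshmans_dream'[OF assms refl, of "x - y" y n] by simp
    with that show ?thesis by simp
  qed
  then have "inj (\<lambda>x :: 'a. x ^ CHAR('a) ^ n)"
    by (rule injI)
  then show ?thesis
    by (simp add: bij_def finite_UNIV_inj_surj)
qed

lemma of_int_power_CHAR:
  assumes "prime CHAR('a :: {field,finite})"
  shows "(of_int z :: 'a) ^ CHAR('a) ^ n = of_int z"
proof -
  have nat: "(of_nat j :: 'a) ^ CHAR('a) ^ n = of_nat j" for j
    using prime_gt_0_nat[OF assms]
    by (induction j) (simp_all add: freshmans_dream'[OF assms refl])
  \<comment> \<open>Reduction modulo the characteristic replaces \<open>z\<close> by a natural
    number, where induction applies.\<close>
  have "of_int z = (of_int (int CHAR('a) * (z div int CHAR('a)) + z mod int CHAR('a)) :: 'a)"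
    by simp
  also have "\<dots> = of_int (z mod int CHAR('a))"
    unfolding of_int_add of_int_mult by simp
  also have "\<dots> = of_nat (nat (z mod int CHAR('a)))"
    using prime_gt_0_nat[OF assms] by simp
  finally have "of_int z = (of_nat (nat (z mod int CHAR('a))) :: 'a)" .
  with nat show ?thesis by metis
qed

section \<open>Antidiagonal autotopisms\<close>

text \<open>With \<open>k = k' e\<close> and \<open>m = m' e\<close>, the odd \<open>m'\<close>
  forces \<open>e = 2 f\<close>. Then \<open>k + m div 2 = f (2 k' + m')\<close> and
  \<open>m = f (2 m')\<close>, where \<open>2 k' + m'\<close> is odd and coprime to
  \<open>m'\<close>.\<close>

lemma gcd_half_shift:
  fixes k m :: nat
  assumes "even m" "odd (m div gcd k m)"
  shows "gcd k m = 2 * gcd (k + m div 2) m"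
    and "odd ((k + m div 2) div gcd (k + m div 2) m)"
proof -
  define e where "e = gcd k m"
  have "e \<noteq> 0"
    using assms(2) by (auto simp: e_def intro: ccontr)
  then obtain k' m' where k: "k = k' * e" and m: "m = m' * e" and cop: "coprime k' m'"
    using gcd_coprime_exists[of k m] unfolding e_def by blast
  have odd: "odd m'"
    using assms(2) \<open>e \<noteq> 0\<close> m by (metis e_def nonzero_mult_div_cancel_right)
  with assms(1) m have "even e" by simp
  then obtain f where f: "e = 2 * f" by blast
  then have half: "k + m div 2 = f * (2 * k' + m')" and mf: "m = f * (2 * m')"
    by (simp_all add: k m algebra_simps)
  have "coprime (2 * k') m'"
    using cop odd by simp
  then have "coprime (2 * k' + m') m'"
    by (simp add: coprime_iff_gcd_eq_1)
  then have "coprime (2 * k' + m') (2 * m')"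
    using odd by simp
  then have "gcd (f * (2 * k' + m')) (f * (2 * m')) = f"
    unfolding gcd_mult_distrib_nat[symmetric] by simp
  then have gcd: "gcd (k + m div 2) m = f"
    unfolding half[symmetric] mf[symmetric] .
  then show "gcd k m = 2 * gcd (k + m div 2) m"
    using f e_def by simp
  show "odd ((k + m div 2) div gcd (k + m div 2) m)"
    using odd \<open>e \<noteq> 0\<close> f unfolding gcd unfolding half by simp
qed

text \<open>The value at 1 gives \<open>a + b\<close>; subtracting \<open>z\<close> times it from
  the value at \<open>z\<close> leaves \<open>a * (z ^ n - z)\<close>.\<close>

lemma power_pair_coeffs_unique:
  fixes a b a' b' z :: "'a :: field"
  assumes "\<And>x. a * x ^ n + b * x = a' * x ^ n + b' * x" and "z ^ n \<noteq> z"
  shows "a = a' \<and> b = b'"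
proof -
  have one: "a + b = a' + b'"
    using assms(1)[of 1] by simp
  have "(a - a') * (z ^ n - z) = (a * z ^ n + b * z) - (a' * z ^ n + b' * z)
      - ((a + b) - (a' + b')) * z"
    by (simp add: algebra_simps)
  also have "\<dots> = 0"
    using one assms(1)[of z] by simp
  finally show ?thesis
    using one assms(2) by simp
qed

lemma linear_over_frobenius:
  assumes "prime CHAR('a :: {field,finite})"
  shows "linear_over (prime_field :: 'a set)
    (\<lambda>(x, y). (a * x ^ CHAR('a) ^ i, b * y ^ CHAR('a) ^ i))"
    and "linear_over (prime_field :: 'a set)
    (\<lambda>(x, y). (a * y ^ CHAR('a) ^ i, b * x ^ CHAR('a) ^ i))"
  by (auto simp: linear_over_def prime_field_def power_mult_distrib of_int_power_CHAR[OF assms]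
        freshmans_dream'[OF assms refl] algebra_simps)

lemma bij_frobenius_pair:
  fixes a b :: "'a :: {field,finite}"
  assumes "prime CHAR('a)" "a \<noteq> 0" "b \<noteq> 0"
  shows "bij (\<lambda>(x, y). (a * x ^ CHAR('a) ^ i, b * y ^ CHAR('a) ^ i))"
    and "bij (\<lambda>(x, y). (a * y ^ CHAR('a) ^ i, b * x ^ CHAR('a) ^ i))"
proof -
  have "inj (\<lambda>x :: 'a. x ^ CHAR('a) ^ i)"
    using bij_frobenius_power[OF assms(1)] by (rule bij_is_inj)
  then have inj: "x ^ CHAR('a) ^ i = y ^ CHAR('a) ^ i \<longleftrightarrow> x = y" for x y :: 'a
    by (auto dest: injD)
  have "inj (\<lambda>(x, y). (a * x ^ CHAR('a) ^ i, b * y ^ CHAR('a) ^ i))"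
    using assms(2,3) by (auto intro!: injI simp: inj)
  then show "bij (\<lambda>(x, y). (a * x ^ CHAR('a) ^ i, b * y ^ CHAR('a) ^ i))"
    by (simp add: bij_def finite_UNIV_inj_surj)
  have "inj (\<lambda>(x, y). (a * y ^ CHAR('a) ^ i, b * x ^ CHAR('a) ^ i))"
    using assms(2,3) by (auto intro!: injI simp: inj)
  then show "bij (\<lambda>(x, y). (a * y ^ CHAR('a) ^ i, b * x ^ CHAR('a) ^ i))"
    by (simp add: bij_def finite_UNIV_inj_surj)
qed

text \<open>The shapes of \<open>X\<close> and \<open>Y\<close> in the theorem, with
  \<open>s\<close> standing for \<open>p ^ i\<close>.\<close>

definition diag_map :: "nat \<Rightarrow> 'a \<Rightarrow> 'a \<Rightarrow> 'a \<times> 'a \<Rightarrow> 'a::field \<times> 'a" where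
  "diag_map s a b = (\<lambda>(x, y). (a * x ^ s, b * y ^ s))"

definition antidiag_map :: "nat \<Rightarrow> 'a \<Rightarrow> 'a \<Rightarrow> 'a \<times> 'a \<Rightarrow> 'a::field \<times> 'a" where
  "antidiag_map s a b = (\<lambda>(x, y). (a * y ^ s, b * x ^ s))"

lemma diag_map_eq_iff: "diag_map s a b = diag_map s a' b' \<longleftrightarrow> a = a' \<and> b = b'"
  by (auto simp: diag_map_def dest!: fun_cong[where x = "(1, 1)"])

lemma antidiag_map_eq_iff: "antidiag_map s a b = antidiag_map s a' b' \<longleftrightarrow> a = a' \<and> b = b'"
  by (auto simp: antidiag_map_def dest!: fun_cong[where x = "(1, 1)"])

text \<open>
  \<^term>\<open>n\<close> is the cardinality of the fixed field \<^term>\<open>D\<close> of the \<^term>\<open>r\<close>-power map; the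
  fixed field \<^term>\<open>E\<close> of the \<^term>\<open>q\<close>-power map is its quadratic extension, on which the
  \<^term>\<open>r\<close>-power map is the nontrivial automorphism \<^term>\<open>\<lambda>x. x ^ n\<close> over \<^term>\<open>D\<close>.
\<close>

locale quadratic_tower =
  fixes q r n :: nat and D E :: "'a :: {field,finite} set" and A B :: 'a
  assumes prime_CHAR: "prime CHAR('a)"
    and q_power: "\<exists>j. q = CHAR('a) ^ j" and r_power: "\<exists>j. r = CHAR('a) ^ j"
    and D: "is_subfield D" and E: "is_subfield E"
    and card_D: "card D = n" and card_E: "card E = n ^ 2"
    and mem_E: "x \<in> E \<longleftrightarrow> x ^ q = x" and mem_D: "x \<in> D \<longleftrightarrow> x ^ r = x"
    and r_E: "x \<in> E \<Longrightarrow> x ^ r = x ^ n"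
    and E_proper: "E \<noteq> UNIV" and D_proper: "D \<noteq> UNIV"
    and A: "A \<noteq> 0" and B: "B \<noteq> 0"
begin

lemma D_subset_E: "D \<subseteq> E"
proof
  fix x assume "x \<in> D"
  then have "x ^ n = x"
    using is_subfield_power_card[OF D] card_D by simp
  then have "x ^ (n ^ 2) = x"
    by (simp add: power2_eq_square power_mult)
  then show "x \<in> E"
    using is_subfield_mem_iff[OF E] card_E by simp
qed

lemma conj_conj: "x \<in> E \<Longrightarrow> (x ^ n) ^ n = x"
  using is_subfield_power_card[OF E, of x] card_E by (simp add: power2_eq_square power_mult)

lemma norm_mem_D: "x \<in> E \<Longrightarrow> x ^ (n + 1) \<in> D"
  using is_subfield_mem_iff[OF D] card_D conj_conj by (simp add: power_mult_distrib mult.commute)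

lemma r_pos: "0 < r"
  using r_power prime_gt_0_nat[OF prime_CHAR] by auto

lemma power_r_minus_1_eq_iff:
  "\<alpha> \<noteq> 0 \<Longrightarrow> \<alpha> ^ (r - 1) = c \<longleftrightarrow> \<alpha> ^ r = c * \<alpha>" for \<alpha> c :: 'a
  using r_pos by (cases r) auto

text \<open>The conditions of the theorem for \<open>s = p ^ i\<close>. An autotopism yields them
  with \<delta> a norm from \<open>E\<close>, while the count starts from an arbitrary
  \<delta>.\<close>

definition solution :: "nat \<Rightarrow> 'a \<Rightarrow> 'a \<Rightarrow> bool" where
  "solution s \<alpha> \<delta> \<longleftrightarrow> \<delta> \<in> D \<and> \<alpha> ^ (r - 1) = A ^ (s + 1) \<and> \<alpha> ^ (q + 1) * \<delta> = B ^ (s + 1)"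

lemma solution_nonzero:
  assumes "solution s \<alpha> \<delta>"
  shows "\<alpha> \<noteq> 0" "\<delta> \<noteq> 0"
proof -
  have "\<alpha> ^ (q + 1) * \<delta> \<noteq> 0"
    using assms B by (simp add: solution_def)
  then show "\<alpha> \<noteq> 0" "\<delta> \<noteq> 0" by auto
qed

section \<open>Autotopisms and their parameters\<close>

text \<open>
  The single map with \<open>u = v = 1\<close> already forces all the constraints, through
  \<open>\<alpha> = w / c2\<close> and \<open>\<gamma> = b2 / w\<close>.
\<close>

lemma autotopism_params:
  assumes s: "s = CHAR('a) ^ i"
    and R: "diag_map s a1 d1 \<circ> R_map q r A B 1 1 = R_map q r A B w t \<circ> antidiag_map s b2 c2"
    and nz: "a1 \<noteq> 0" "d1 \<noteq> 0" "b2 \<noteq> 0" "c2 \<noteq> 0"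
  shows "\<exists>\<alpha> \<gamma>. \<gamma> \<in> E - {0} \<and> solution s \<alpha> (\<gamma> ^ (n + 1)) \<and>
    a1 = B * c2 ^ (q + 1) / \<gamma> ^ n \<and> d1 = A * \<alpha> * c2 ^ (r + 1) \<and> b2 = \<alpha> * c2 * \<gamma>"
proof -
  have add: "(x + y) ^ s = x ^ s + y ^ s" for x y :: 'a
    using freshmans_dream'[OF prime_CHAR s] .
  have s_pos: "0 < s"
    using s prime_gt_0_nat[OF prime_CHAR] by simp
  have q_pos: "0 < q"
    using q_power prime_gt_0_nat[OF prime_CHAR] by auto
  have surj: "\<exists>x. z = x ^ s" for z :: 'a
    using bij_is_surj[OF bij_frobenius_power[OF prime_CHAR, of i]] s by (metis surjD)
  have eq: "(a1 * (x ^ q + x + B * (y ^ q + y)) ^ s = (b2 * y ^ s) ^ q * w + b2 * y ^ s * w ^ q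
        + B * ((c2 * x ^ s) ^ q * t + c2 * x ^ s * t ^ q)) \<and>
      (d1 * (x ^ r + A * x + A * y ^ r + y) ^ s = (b2 * y ^ s) ^ r * t + A * (b2 * y ^ s) * t ^ r
        + A * (c2 * x ^ s) ^ r * w + c2 * x ^ s * w ^ r)" for x y
    using fun_cong[OF R, of "(x, y)"] by (simp add: diag_map_def antidiag_map_def R_map_def)
  \<comment> \<open>These witnesses make the coefficients of \<open>z ^ q\<close> and
    \<open>z\<close>, and of \<open>z ^ r\<close> and \<open>z\<close>, comparable.\<close>
  obtain z1 :: 'a where z1: "z1 ^ q \<noteq> z1"
    using E_proper mem_E by blast
  obtain z2 :: 'a where z2: "z2 ^ r \<noteq> z2"
    using D_proper mem_D by blast
  have comm: "(x ^ s) ^ q = (x ^ q) ^ s" "(x ^ s) ^ r = (x ^ r) ^ s" for x :: 'a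
    by (simp_all add: mult.commute flip: power_mult)
  \<comment> \<open>Each of the four comparisons sets one coordinate to 0 in one component of
    \<open>eq\<close>; as \<open>x ^ s\<close> takes every value, it serves as the free variable
    \<open>z\<close>.\<close>
  have 1: "a1 = B * c2 ^ q * t \<and> a1 = B * c2 * t ^ q"
  proof (rule power_pair_coeffs_unique[OF _ z1])
    fix z :: 'a
    obtain x where "z = x ^ s" using surj by blast
    then show "a1 * z ^ q + a1 * z = B * c2 ^ q * t * z ^ q + B * c2 * t ^ q * z"
      using conjunct1[OF eq[of x 0]]
      by (simp add: zero_power[OF s_pos] zero_power[OF q_pos] add comm power_mult_distrib algebra_simps)
  qed
  have 2: "a1 * B ^ s = b2 ^ q * w \<and> a1 * B ^ s = b2 * w ^ q"
  proof (rule power_pair_coeffs_unique[OF _ z1])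
    fix z :: 'a
    obtain x where "z = x ^ s" using surj by blast
    then show "a1 * B ^ s * z ^ q + a1 * B ^ s * z = b2 ^ q * w * z ^ q + b2 * w ^ q * z"
      using conjunct1[OF eq[of 0 x]]
      by (simp add: zero_power[OF s_pos] zero_power[OF q_pos] add comm power_mult_distrib algebra_simps)
  qed
  have 3: "d1 = A * c2 ^ r * w \<and> d1 * A ^ s = c2 * w ^ r"
  proof (rule power_pair_coeffs_unique[OF _ z2])
    fix z :: 'a
    obtain x where "z = x ^ s" using surj by blast
    then show "d1 * z ^ r + d1 * A ^ s * z = A * c2 ^ r * w * z ^ r + c2 * w ^ r * z"
      using conjunct2[OF eq[of x 0]]
      by (simp add: zero_power[OF s_pos] zero_power[OF r_pos] add comm power_mult_distrib algebra_simps)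
  qed
  have 4: "d1 * A ^ s = b2 ^ r * t \<and> d1 = A * b2 * t ^ r"
  proof (rule power_pair_coeffs_unique[OF _ z2])
    fix z :: 'a
    obtain x where "z = x ^ s" using surj by blast
    then show "d1 * A ^ s * z ^ r + d1 * z = b2 ^ r * t * z ^ r + A * b2 * t ^ r * z"
      using conjunct2[OF eq[of 0 x]]
      by (simp add: zero_power[OF s_pos] zero_power[OF r_pos] add comm power_mult_distrib algebra_simps)
  qed
  have w: "w \<noteq> 0" using 3 nz by auto
  define \<alpha> where "\<alpha> = w / c2"
  define \<gamma> where "\<gamma> = b2 / w"
  have w_eq: "w = \<alpha> * c2" and b2_eq: "b2 = \<alpha> * c2 * \<gamma>"
    using w nz by (simp_all add: \<alpha>_def \<gamma>_def)
  have \<alpha>: "\<alpha> \<noteq> 0" and \<gamma>: "\<gamma> \<noteq> 0"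
    using w nz by (simp_all add: \<alpha>_def \<gamma>_def)
  have "b2 ^ q * w = b2 * w ^ q"
    using 2 by metis
  then have "\<gamma> ^ q = \<gamma>"
    using w by (simp add: \<gamma>_def power_divide field_simps)
  then have \<gamma>E: "\<gamma> \<in> E"
    using mem_E by simp
  have "c2 * w ^ r = A ^ (s + 1) * c2 ^ r * w"
    using 3 by (metis mult.assoc mult.commute power_Suc2 Suc_eq_plus1)
  then have "\<alpha> ^ r = A ^ (s + 1) * \<alpha>"
    using nz unfolding w_eq power_mult_distrib by (simp add: mult.assoc mult.left_commute)
  then have A_eq: "\<alpha> ^ (r - 1) = A ^ (s + 1)"
    using power_r_minus_1_eq_iff \<alpha> by blast
  \<comment> \<open>Dividing by \<open>w ^ r\<close> determines \<open>t\<close> as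
    \<open>c2\<close> over the conjugate of \<gamma>.\<close>
  have "b2 ^ r * t = c2 * w ^ r"
    using 3 4 by metis
  then have "(\<gamma> ^ r * t) * w ^ r = c2 * w ^ r"
    using w by (simp add: \<gamma>_def power_divide)
  then have t: "\<gamma> ^ n * t = c2"
    using w r_E[OF \<gamma>E] by simp
  have a1: "a1 * \<gamma> ^ n = B * c2 ^ (q + 1)"
    using 1 t by (metis mult.assoc mult.commute power_Suc2 Suc_eq_plus1)
  \<comment> \<open>The second equation, multiplied by the nonzero \<open>c2 ^ (q + 1)\<close>,
    comes from expressing \<open>a1\<close> in two ways, by \<open>1\<close> and by
    \<open>2\<close>.\<close>
  have "B ^ (s + 1) * c2 ^ (q + 1) = (a1 * \<gamma> ^ n) * B ^ s"
    unfolding a1 by simp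
  also have "\<dots> = \<gamma> ^ n * (b2 * w ^ q)"
    by (simp add: conjunct2[OF 2, symmetric] mult_ac)
  also have "\<dots> = \<alpha> ^ (q + 1) * \<gamma> ^ (n + 1) * c2 ^ (q + 1)"
    by (simp add: b2_eq w_eq power_mult_distrib)
  finally have B_eq: "\<alpha> ^ (q + 1) * \<gamma> ^ (n + 1) = B ^ (s + 1)"
    using nz by simp
  have "a1 = B * c2 ^ (q + 1) / \<gamma> ^ n"
    using a1 \<gamma> by (simp add: field_simps)
  moreover have "d1 = A * \<alpha> * c2 ^ (r + 1)"
    using 3 w_eq by simp
  ultimately show ?thesis
    using \<gamma>E \<gamma> A_eq B_eq b2_eq norm_mem_D[OF \<gamma>E] unfolding solution_def by blast
qed

text \<open>Since \<open>antidiag_map\<close> exchanges the coordinates, \<open>u\<close> and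
  \<open>v\<close> exchange roles too. At \<open>u = v = 1\<close> the new parameters are the
  \<open>w\<close> and \<open>t\<close> of the converse direction.\<close>

lemma params_autotopism:
  assumes s: "s = CHAR('a) ^ i"
    and \<gamma>: "\<gamma> \<in> E" "\<gamma> \<noteq> 0" and sol: "solution s \<alpha> (\<gamma> ^ (n + 1))"
    and c2: "c2 \<noteq> 0"
    and a1: "a1 = B * c2 ^ (q + 1) / \<gamma> ^ n" and d1: "d1 = A * \<alpha> * c2 ^ (r + 1)"
    and b2: "b2 = \<alpha> * c2 * \<gamma>"
  shows "diag_map s a1 d1 \<circ> R_map q r A B u v
    = R_map q r A B (\<alpha> * c2 * v ^ s) (c2 * u ^ s / \<gamma> ^ n) \<circ> antidiag_map s b2 c2"
proof
  fix z :: "'a \<times> 'a"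
  obtain x y where z: "z = (x, y)" by fastforce
  have add: "(x + y) ^ s = x ^ s + y ^ s" for x y :: 'a
    using freshmans_dream'[OF prime_CHAR s] .
  have comm: "(x ^ s) ^ j = (x ^ j) ^ s" for x :: 'a and j
    by (simp add: mult.commute flip: power_mult)
  have \<gamma>q: "\<gamma> ^ q = \<gamma>" and \<gamma>r: "\<gamma> ^ r = \<gamma> ^ n"
    using \<gamma> mem_E r_E by auto
  have \<gamma>nq: "(\<gamma> ^ n) ^ q = \<gamma> ^ n" and \<gamma>nr: "(\<gamma> ^ n) ^ r = \<gamma>"
    using mem_E r_E is_subfield_power[OF E \<gamma>(1), of n] conj_conj[OF \<gamma>(1)] by auto
  have \<alpha>r: "\<alpha> ^ r = A ^ (s + 1) * \<alpha>"
    using sol solution_nonzero[OF sol] power_r_minus_1_eq_iff by (simp add: solution_def)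
  have B_eq: "B * B ^ s = \<alpha> * \<alpha> ^ q * (\<gamma> * \<gamma> ^ n)"
    using sol by (simp add: solution_def)
  \<comment> \<open>The norm equation enters the first component here, as the coefficient of the
    terms in \<open>Y\<close>; the second component uses the equation for
    \<open>\<alpha> ^ r\<close> instead.\<close>
  have 1: "a1 * B ^ s = \<alpha> * \<alpha> ^ q * \<gamma> * (c2 * c2 ^ q)"
    using B_eq \<gamma> by (simp add: a1 field_simps)
  define X where "X = x ^ s"
  define Y where "Y = y ^ s"
  define U where "U = u ^ s"
  define V where "V = v ^ s"
  have "a1 * (x ^ q * u + x * u ^ q + B * (y ^ q * v + y * v ^ q)) ^ s
      = a1 * (X ^ q * U + X * U ^ q) + a1 * B ^ s * (Y ^ q * V + Y * V ^ q)"
    by (simp add: add power_mult_distrib comm X_def Y_def U_def V_def algebra_simps)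
  also have "\<dots> = (b2 * Y) ^ q * (\<alpha> * c2 * V) + b2 * Y * (\<alpha> * c2 * V) ^ q
        + B * ((c2 * X) ^ q * (c2 * U / \<gamma> ^ n) + c2 * X * (c2 * U / \<gamma> ^ n) ^ q)"
    unfolding 1 using \<gamma>
    by (simp add: a1 b2 power_mult_distrib power_divide \<gamma>q \<gamma>nq field_simps)
  finally have fst: "a1 * (x ^ q * u + x * u ^ q + B * (y ^ q * v + y * v ^ q)) ^ s
      = (b2 * Y) ^ q * (\<alpha> * c2 * V) + b2 * Y * (\<alpha> * c2 * V) ^ q
        + B * ((c2 * X) ^ q * (c2 * U / \<gamma> ^ n) + c2 * X * (c2 * U / \<gamma> ^ n) ^ q)" .
  have "d1 * (x ^ r * v + A * x * v ^ r + A * y ^ r * u + y * u ^ r) ^ s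
      = d1 * (X ^ r * V + A ^ s * X * V ^ r + A ^ s * Y ^ r * U + Y * U ^ r)"
    by (simp add: add power_mult_distrib comm X_def Y_def U_def V_def)
  also have "\<dots> = (b2 * Y) ^ r * (c2 * U / \<gamma> ^ n) + A * (b2 * Y) * (c2 * U / \<gamma> ^ n) ^ r
        + A * (c2 * X) ^ r * (\<alpha> * c2 * V) + c2 * X * (\<alpha> * c2 * V) ^ r"
    using \<gamma>
    by (simp add: d1 b2 power_mult_distrib power_divide \<gamma>r \<gamma>nr \<alpha>r field_simps)
  finally have snd: "d1 * (x ^ r * v + A * x * v ^ r + A * y ^ r * u + y * u ^ r) ^ s
      = (b2 * Y) ^ r * (c2 * U / \<gamma> ^ n) + A * (b2 * Y) * (c2 * U / \<gamma> ^ n) ^ r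
        + A * (c2 * X) ^ r * (\<alpha> * c2 * V) + c2 * X * (\<alpha> * c2 * V) ^ r" .
  show "(diag_map s a1 d1 \<circ> R_map q r A B u v) z
    = (R_map q r A B (\<alpha> * c2 * v ^ s) (c2 * u ^ s / \<gamma> ^ n) \<circ> antidiag_map s b2 c2) z"
    using fst snd
    by (simp add: z diag_map_def antidiag_map_def R_map_def X_def Y_def U_def V_def)
qed

lemma Aut_iff:
  assumes s: "s = CHAR('a) ^ i"
    and nz: "a1 \<noteq> 0" "d1 \<noteq> 0" "b2 \<noteq> 0" "c2 \<noteq> 0"
  shows "(diag_map s a1 d1, antidiag_map s b2 c2) \<in> Aut_set (C_set q r A B) \<longleftrightarrow>
    (\<exists>\<alpha> \<gamma>. \<gamma> \<in> E - {0} \<and> solution s \<alpha> (\<gamma> ^ (n + 1)) \<and>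
      a1 = B * c2 ^ (q + 1) / \<gamma> ^ n \<and> d1 = A * \<alpha> * c2 ^ (r + 1) \<and> b2 = \<alpha> * c2 * \<gamma>)"
    (is "?L \<longleftrightarrow> ?R")
proof
  assume ?L
  moreover have "R_map q r A B 1 1 \<in> C_set q r A B"
    by (auto simp: C_set_def)
  ultimately obtain w t where
    "diag_map s a1 d1 \<circ> R_map q r A B 1 1 = R_map q r A B w t \<circ> antidiag_map s b2 c2"
    unfolding Aut_set_def C_set_def by blast
  from autotopism_params[OF s this nz] show ?R .
next
  assume ?R
  then have "\<exists>R'\<in>C_set q r A B. diag_map s a1 d1 \<circ> R = R' \<circ> antidiag_map s b2 c2"
    if "R \<in> C_set q r A B" for R
    using that params_autotopism[OF s] nz unfolding C_set_def by blast
  then show ?L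
    using linear_over_frobenius[OF prime_CHAR] bij_frobenius_pair[OF prime_CHAR] nz
    by (simp add: Aut_set_def diag_map_def antidiag_map_def s)
qed

section \<open>Counting the autotopisms\<close>

lemma card_norm_square:
  assumes "solution s \<alpha> \<delta>"
  shows "card {(\<gamma>, \<epsilon>). \<gamma> \<in> E \<and> \<epsilon> \<in> D \<and> \<delta> = \<gamma> ^ (n + 1) * \<epsilon> ^ 2} = n ^ 2 - 1"
  using card_field_norm_times_square[OF D E, of \<delta>] card_D card_E assms
    solution_nonzero[OF assms] by (simp add: solution_def)

text \<open>The map \<open>f\<close> parametrises the pairs bijectively by a free nonzero
  \<open>c\<close> and a representation of \<delta>, with \<alpha> kept as base point and
  \<open>\<alpha> * \<epsilon>\<close> as the varying solution.\<close>

lemma card_antidiag_autotopisms: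
  assumes s: "s = CHAR('a) ^ i" and sol: "solution s \<alpha> \<delta>"
  shows "card {(X, Y). (X, Y) \<in> Aut_set (C_set q r A B) \<and>
      (\<exists>a1 d1 b2 c2. a1 \<noteq> 0 \<and> d1 \<noteq> 0 \<and> b2 \<noteq> 0 \<and> c2 \<noteq> 0 \<and>
        X = diag_map s a1 d1 \<and> Y = antidiag_map s b2 c2)} = (CARD('a) - 1) * (n ^ 2 - 1)"
    (is "card ?S = _")
proof -
  define G where "G = {(\<gamma>, \<epsilon>). \<gamma> \<in> E \<and> \<epsilon> \<in> D \<and> \<delta> = \<gamma> ^ (n + 1) * \<epsilon> ^ 2}"
  define f where "f = (\<lambda>(c, \<gamma>, \<epsilon>).
    (diag_map s (B * c ^ (q + 1) / \<gamma> ^ n) (A * (\<alpha> * \<epsilon>) * c ^ (r + 1)),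
     antidiag_map s (\<alpha> * \<epsilon> * c * \<gamma>) c))"
  note \<alpha>\<delta> = solution_nonzero[OF sol]
  have n_pos: "0 < n"
    using is_subfield_card_gt_1[OF D] card_D by simp
  have G_nz: "\<gamma> \<noteq> 0 \<and> \<epsilon> \<noteq> 0" if "(\<gamma>, \<epsilon>) \<in> G" for \<gamma> \<epsilon>
    using that \<alpha>\<delta> by (auto simp: G_def)
  have sol_iff: "solution s (\<alpha> * \<epsilon>) (\<gamma> ^ (n + 1)) \<longleftrightarrow> (\<gamma>, \<epsilon>) \<in> G"
    if "\<gamma> \<in> E" "\<gamma> \<noteq> 0" "\<epsilon> \<noteq> 0" for \<gamma> \<epsilon>
  proof -
    have "(\<alpha> * \<epsilon>) ^ (r - 1) = A ^ (s + 1) \<longleftrightarrow> \<epsilon> ^ (r - 1) = 1"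
      using sol A by (simp add: solution_def power_mult_distrib)
    also have "\<dots> \<longleftrightarrow> \<epsilon> \<in> D"
      using power_r_minus_1_eq_iff that mem_D by simp
    finally have 1: "(\<alpha> * \<epsilon>) ^ (r - 1) = A ^ (s + 1) \<longleftrightarrow> \<epsilon> \<in> D" .
    \<comment> \<open>On \<open>D\<close>, which lies in \<open>E\<close>, the
      \<open>q\<close>-power map is trivial, so raising \<epsilon> to the power \<open>q + 1\<close>
      is squaring.\<close>
    have 2: "(\<alpha> * \<epsilon>) ^ (q + 1) * \<gamma> ^ (n + 1) = B ^ (s + 1) \<longleftrightarrow> \<delta> = \<gamma> ^ (n + 1) * \<epsilon> ^ 2"
      if "\<epsilon> \<in> D"
    proof -
      have "\<epsilon> ^ q = \<epsilon>"
        using that D_subset_E mem_E by blast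
      then have "(\<alpha> * \<epsilon>) ^ (q + 1) * \<gamma> ^ (n + 1) = \<alpha> ^ (q + 1) * (\<gamma> ^ (n + 1) * \<epsilon> ^ 2)"
        by (simp add: power_mult_distrib power2_eq_square)
      moreover have "B ^ (s + 1) = \<alpha> ^ (q + 1) * \<delta>"
        using sol by (simp add: solution_def)
      ultimately show ?thesis
        using \<alpha>\<delta> by (metis mult_left_cancel power_not_zero)
    qed
    show ?thesis
      using 1 2 that norm_mem_D by (auto simp: solution_def G_def)
  qed
  have "inj_on f ((UNIV - {0}) \<times> G)"
  proof (rule inj_onI)
    fix z z' assume mem: "z \<in> (UNIV - {0}) \<times> G" "z' \<in> (UNIV - {0}) \<times> G" and f: "f z = f z'"
    obtain c \<gamma> \<epsilon> c' \<gamma>' \<epsilon>' where z: "z = (c, \<gamma>, \<epsilon>)" "z' = (c', \<gamma>', \<epsilon>')"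
      by (metis prod_cases3)
    with mem have nz: "c \<noteq> 0" "c' \<noteq> 0" and G: "(\<gamma>, \<epsilon>) \<in> G" "(\<gamma>', \<epsilon>') \<in> G"
      by simp_all
    have eq: "f (c, \<gamma>, \<epsilon>) = f (c', \<gamma>', \<epsilon>')"
      using f by (simp only: z)
    \<comment> \<open>The parameters are recovered in turn: \<open>c\<close> from the second map,
      then \<epsilon> from the second coefficient of the first map, then \<gamma> from the remaining
      coefficient of the second.\<close>
    from eq have c: "c = c'" and b: "\<alpha> * \<epsilon> * c * \<gamma> = \<alpha> * \<epsilon>' * c' * \<gamma>'"
      and d: "A * (\<alpha> * \<epsilon>) * c ^ (r + 1) = A * (\<alpha> * \<epsilon>') * c' ^ (r + 1)"
      unfolding f_def prod.case prod.inject diag_map_eq_iff antidiag_map_eq_iff by blast+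
    have \<epsilon>: "\<epsilon> = \<epsilon>'"
      using d nz A \<alpha>\<delta> unfolding c by simp
    moreover have "\<gamma> = \<gamma>'"
      using b nz \<alpha>\<delta> G_nz[OF G(2)] unfolding c \<epsilon> by simp
    ultimately show "z = z'"
      using c z by simp
  qed
  moreover have "f ` ((UNIV - {0}) \<times> G) = ?S"
  proof (intro equalityI subsetI)
    fix z assume "z \<in> f ` ((UNIV - {0}) \<times> G)"
    then obtain c \<gamma> \<epsilon> where c: "c \<noteq> 0" and G: "(\<gamma>, \<epsilon>) \<in> G" and z: "z = f (c, \<gamma>, \<epsilon>)"
      by auto
    have \<gamma>: "\<gamma> \<in> E" "\<gamma> \<noteq> 0" "\<epsilon> \<noteq> 0"
      using G G_nz[OF G] unfolding G_def by blast+
    have nz: "B * c ^ (q + 1) / \<gamma> ^ n \<noteq> 0" "A * (\<alpha> * \<epsilon>) * c ^ (r + 1) \<noteq> 0"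
      "\<alpha> * \<epsilon> * c * \<gamma> \<noteq> 0"
      using c A B \<alpha>\<delta> \<gamma> by simp_all
    have "f (c, \<gamma>, \<epsilon>) \<in> Aut_set (C_set q r A B)"
      unfolding f_def prod.case Aut_iff[OF s nz c]
      by (intro exI[of _ "\<alpha> * \<epsilon>"] exI[of _ \<gamma>]) (use \<gamma> G sol_iff[OF \<gamma>] in simp)
    then show "z \<in> ?S"
      unfolding z f_def prod.case mem_Collect_eq using nz c by blast
  next
    fix z assume "z \<in> ?S"
    then obtain a1 d1 b2 c2 where nz: "a1 \<noteq> 0" "d1 \<noteq> 0" "b2 \<noteq> 0" "c2 \<noteq> 0"
      and z: "z = (diag_map s a1 d1, antidiag_map s b2 c2)"
      and Aut: "z \<in> Aut_set (C_set q r A B)"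
      by auto
    from Aut obtain \<alpha>' \<gamma> where \<gamma>: "\<gamma> \<in> E" "\<gamma> \<noteq> 0" and sol': "solution s \<alpha>' (\<gamma> ^ (n + 1))"
      and eqs: "a1 = B * c2 ^ (q + 1) / \<gamma> ^ n" "d1 = A * \<alpha>' * c2 ^ (r + 1)" "b2 = \<alpha>' * c2 * \<gamma>"
      unfolding z Aut_iff[OF s nz] by blast
    define \<epsilon> where "\<epsilon> = \<alpha>' / \<alpha>"
    have \<alpha>': "\<alpha>' = \<alpha> * \<epsilon>" and \<epsilon>: "\<epsilon> \<noteq> 0"
      using \<alpha>\<delta> solution_nonzero[OF sol'] by (simp_all add: \<epsilon>_def)
    then have "(\<gamma>, \<epsilon>) \<in> G"
      using sol_iff[OF \<gamma> \<epsilon>] sol' by simp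
    moreover have "z = f (c2, \<gamma>, \<epsilon>)"
      unfolding z eqs \<alpha>' f_def by simp
    ultimately show "z \<in> f ` ((UNIV - {0}) \<times> G)"
      using nz(4) by (intro image_eqI[where x = "(c2, \<gamma>, \<epsilon>)"]) simp_all
  qed
  ultimately have "card ?S = card ((UNIV - {0 :: 'a}) \<times> G)"
    by (simp add: card_image[symmetric])
  also have "\<dots> = (CARD('a) - 1) * (n ^ 2 - 1)"
    using card_norm_square[OF sol] by (simp add: card_cartesian_product G_def)
  finally show ?thesis .
qed

end

section \<open>Existence and count over the field with \<open>p ^ m\<close> elements\<close>

theorem theorem3p3:
  fixes p m k q r e d Q :: nat
    and A B :: "'a::{field,finite}"
    and E D FQ :: "'a set"
  assumes "prime p" and "odd p" and "even m"
    and "CARD('a) = p ^ m"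
    and "1 \<le> k" and "k \<le> m - 1"
    and "Q = p ^ (m div 2)" and "q = p ^ k" and "r = p ^ (k + m div 2)"
    and "e = gcd k m" and "odd (m div e)" and "d = gcd (k + m div 2) m"
    and "is_subfield E" and "card E = p ^ e"
    and "is_subfield D" and "card D = p ^ d"
    and "is_subfield FQ" and "card FQ = Q"
    and "\<not> (\<exists>c. B = c ^ 2)"
    and "A * B \<in> FQ - {0}"
  shows "(\<forall>i<m. \<forall>X Y a1 d1 b2 c2.
            (X, Y) \<in> Aut_set (C_set q r A B) \<and>
            a1 \<noteq> 0 \<and> d1 \<noteq> 0 \<and> b2 \<noteq> 0 \<and> c2 \<noteq> 0 \<and>
            X = (\<lambda>(x, y). (a1 * x ^ p ^ i, d1 * y ^ p ^ i)) \<and>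
            Y = (\<lambda>(x, y). (b2 * y ^ p ^ i, c2 * x ^ p ^ i)) \<longrightarrow>
            (\<exists>\<alpha>. \<exists>\<delta>\<in>D.
               \<alpha> ^ (r - 1) = A ^ (p ^ i + 1) \<and>
               \<alpha> ^ (q + 1) * \<delta> = B ^ (p ^ i + 1) \<and>
               card {(\<gamma>, \<epsilon>). \<gamma> \<in> E \<and> \<epsilon> \<in> D \<and> \<delta> = \<gamma> ^ (p ^ d + 1) * \<epsilon> ^ 2} = p ^ e - 1)) \<and>
         (\<forall>i<m.
            (\<exists>\<alpha>. \<exists>\<delta>\<in>D.
               \<alpha> ^ (r - 1) = A ^ (p ^ i + 1) \<and>
               \<alpha> ^ (q + 1) * \<delta> = B ^ (p ^ i + 1)) \<longrightarrow>
            card {(X, Y). (X, Y) \<in> Aut_set (C_set q r A B) \<and>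
                    (\<exists>a1 d1 b2 c2.
                       a1 \<noteq> 0 \<and> d1 \<noteq> 0 \<and> b2 \<noteq> 0 \<and> c2 \<noteq> 0 \<and>
                       X = (\<lambda>(x, y). (a1 * x ^ p ^ i, d1 * y ^ p ^ i)) \<and>
                       Y = (\<lambda>(x, y). (b2 * y ^ p ^ i, c2 * x ^ p ^ i)))}
              = (p ^ m - 1) * (p ^ e - 1))"
proof -
  have CHAR: "CHAR('a) = p"
    using CHAR_eq_if_CARD_eq_prime_power assms(1,4) by blast
  note gcd_half = gcd_half_shift[OF assms(3) assms(11)[unfolded assms(10)], folded assms(10,12)]
  have p_gt: "1 < p"
    using assms(1) by (rule prime_gt_1_nat)
  have mem_E: "x \<in> E \<longleftrightarrow> x ^ q = x" for x
    unfolding assms(8)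
    by (rule is_subfield_mem_iff_gcd[OF assms(13) _ assms(4)]) (use assms(10,14) in simp)
  have mem_D: "x \<in> D \<longleftrightarrow> x ^ r = x" for x
    unfolding assms(9)
    by (rule is_subfield_mem_iff_gcd[OF assms(15) _ assms(4)]) (use assms(12,16) in simp)
  have card_E: "card E = (p ^ d) ^ 2"
    using assms(14) gcd_half(1) by (simp add: mult.commute flip: power_mult)
  have r_E: "x ^ r = x ^ (p ^ d)" if "x \<in> E" for x
  proof -
    \<comment> \<open>As \<open>e = 2 d\<close>, the odd quotient gives
      \<open>k + m div 2 = e * j + d\<close>. The part \<open>e * j\<close> acts trivially on
      \<open>E\<close>, leaving the \<open>p ^ d\<close>-power.\<close>
    obtain j where "(k + m div 2) div d = 2 * j + 1"
      using gcd_half(2) by (elim oddE)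
    then have "k + m div 2 = d * (2 * j + 1)"
      using assms(12) by (metis dvd_mult_div_cancel gcd_dvd1)
    then have "k + m div 2 = e * j + d"
      using gcd_half(1) by (simp add: algebra_simps)
    then have "x ^ r = (x ^ (p ^ (e * j))) ^ (p ^ d)"
      unfolding assms(9) by (simp add: power_add power_mult)
    also have "x ^ (p ^ (e * j)) = x"
      using is_subfield_power_card[OF assms(13) that] assms(14) by (intro power_power_fixed) simp
    finally show ?thesis .
  qed
  have "e \<le> k" "0 < e"
    using assms(5,10) by (auto intro: gcd_le1_nat)
  then have "e < m" "d < m"
    using assms(5,6) gcd_half(1) by linarith+
  then have "card E < CARD('a)" "card D < CARD('a)"
    using p_gt assms(4,14,16) by (simp_all add: power_strict_increasing)
  then have proper: "E \<noteq> UNIV" "D \<noteq> UNIV"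
    by auto
  have nz: "A \<noteq> 0" "B \<noteq> 0"
    using assms(20) by auto
  interpret quadratic_tower q r "p ^ d" D E A B
    by unfold_locales
       (use assms(1,8,9,13,15,16) CHAR mem_E mem_D card_E r_E proper nz in auto)
  have p_e: "p ^ e = (p ^ d) ^ 2"
    using card_E assms(14) by simp
  show ?thesis
  proof (intro conjI allI impI; (elim conjE exE bexE)?)
    fix i X Y a1 d1 b2 c2
    assume Aut: "(X, Y) \<in> Aut_set (C_set q r A B)"
      and nz: "a1 \<noteq> 0" "d1 \<noteq> 0" "b2 \<noteq> 0" "c2 \<noteq> 0"
      and X: "X = (\<lambda>(x, y). (a1 * x ^ p ^ i, d1 * y ^ p ^ i))"
      and Y: "Y = (\<lambda>(x, y). (b2 * y ^ p ^ i, c2 * x ^ p ^ i))"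
    from Aut have "(diag_map (p ^ i) a1 d1, antidiag_map (p ^ i) b2 c2) \<in> Aut_set (C_set q r A B)"
      by (simp add: X Y diag_map_def antidiag_map_def)
    then obtain \<alpha> \<gamma> where "solution (p ^ i) \<alpha> (\<gamma> ^ (p ^ d + 1))"
      using Aut_iff[OF _ nz, of "p ^ i" i] CHAR by blast
    \<comment> \<open>The witness for \<delta> is the norm \<open>\<gamma> ^ (p ^ d + 1)\<close>
      itself.\<close>
    with card_norm_square[OF this] show "\<exists>\<alpha>. \<exists>\<delta>\<in>D.
        \<alpha> ^ (r - 1) = A ^ (p ^ i + 1) \<and> \<alpha> ^ (q + 1) * \<delta> = B ^ (p ^ i + 1) \<and>
        card {(\<gamma>, \<epsilon>). \<gamma> \<in> E \<and> \<epsilon> \<in> D \<and> \<delta> = \<gamma> ^ (p ^ d + 1) * \<epsilon> ^ 2} = p ^ e - 1"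
      unfolding solution_def p_e by blast
  next
    fix i \<alpha> \<delta>
    assume "\<delta> \<in> D" "\<alpha> ^ (r - 1) = A ^ (p ^ i + 1)" "\<alpha> ^ (q + 1) * \<delta> = B ^ (p ^ i + 1)"
    then have "solution (p ^ i) \<alpha> \<delta>"
      by (simp add: solution_def)
    from card_antidiag_autotopisms[OF _ this, of i]
    show "card {(X, Y). (X, Y) \<in> Aut_set (C_set q r A B) \<and>
        (\<exists>a1 d1 b2 c2. a1 \<noteq> 0 \<and> d1 \<noteq> 0 \<and> b2 \<noteq> 0 \<and> c2 \<noteq> 0 \<and>
          X = (\<lambda>(x, y). (a1 * x ^ p ^ i, d1 * y ^ p ^ i)) \<and>
          Y = (\<lambda>(x, y). (b2 * y ^ p ^ i, c2 * x ^ p ^ i)))} = (p ^ m - 1) * (p ^ e - 1)"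
      by (simp only: CHAR diag_map_def antidiag_map_def assms(4) p_e simp_thms)
  qed
qed

end
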